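(* $N^*(2,2)=3$; that is, the smallest size of a uniform determinantal representation of the generic polynomial of degree $2$ in $2$ variables is $3$.
   Context: Let $K$ be a field. For $n,d\in\mathbb{Z}_{\ge 0}$ the generic polynomial of degree $d$ in $n$ variables is $p_{n,d}=\sum_{|\alpha|\le d} c_\alpha x^\alpha$, where $x=(x_1,\ldots,x_n)$, $\alpha\in\mathbb{Z}_{\ge 0}^n$, $|\alpha|=\sum_i\alpha_i$, and each $c_\alpha$ is regarded as a variable. A uniform determinantal representation of $p_{n,d}$ of size $N$ is an $N\times N$ matrix $M$ whose entries are $K$-linear combinations of the monomials $1,x_i,c_\alpha,c_\alpha x_i$ ($1\le i\le n$, $|\alpha|\le d$), such that $\det(M)=p_{n,d}$. $N^*(n,d)$ denotes the minimum of all sizes of uniform determinantal representations of $p_{n,d}$. *)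

theory Defs
  imports
    "HOL-Library.Poly_Mapping"
    "HOL-Library.Extended_Nat"
    "Jordan_Normal_Form.Determinant"
begin

text \<open>
  \<open>X i\<close> (for \<open>i < n\<close>, so counted from \<open>0\<close>) is the variable \<open>x\<^sub>i\<^sub>+\<^sub>1\<close>, and \<open>C \<alpha>\<close> is the
  coefficient variable \<open>c\<^sub>\<alpha>\<close>, where the exponent vector \<open>\<alpha>\<close> is a list of length \<open>n\<close>.
\<close>

datatype gvar = X nat | C "nat list"

text \<open>
  Polynomials over \<open>'k\<close>, as finitely supported functions from monomials (finitely supported
  exponent functions) to coefficients. This one ring serves all \<open>n\<close> and \<open>d\<close>; the variables
  that do not belong to a given \<open>p\<^sub>n\<^sub>,\<^sub>d\<close> are simply not used.
\<close>

type_synonym 'k gpoly = "(gvar \<Rightarrow>\<^sub>0 nat) \<Rightarrow>\<^sub>0 'k"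

definition var :: "gvar \<Rightarrow> 'k::field gpoly" where
  "var v = Poly_Mapping.single (Poly_Mapping.single v 1) 1"

definition gscale :: "'k::field \<Rightarrow> 'k gpoly \<Rightarrow> 'k gpoly" where
  "gscale a p = Poly_Mapping.single 0 a * p"

global_interpretation gpoly: vector_space "gscale :: 'k::field \<Rightarrow> 'k gpoly \<Rightarrow> 'k gpoly"
  by unfold_locales
    (simp_all add: gscale_def algebra_simps single_add mult_single flip: mult.assoc)

definition exponents :: "nat \<Rightarrow> nat \<Rightarrow> nat list set" where
  "exponents n d = {\<alpha>. length \<alpha> = n \<and> sum_list \<alpha> \<le> d}"

definition generic_poly :: "nat \<Rightarrow> nat \<Rightarrow> 'k::field gpoly" where
  "generic_poly n d =
    (\<Sum>\<alpha>\<in>exponents n d. var (C \<alpha>) * (\<Prod>i<n. var (X i) ^ (\<alpha> ! i)))"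

definition entry_monomials :: "nat \<Rightarrow> nat \<Rightarrow> 'k::field gpoly set" where
  "entry_monomials n d =
    {1} \<union> {var (X i) | i. i < n} \<union> {var (C \<alpha>) | \<alpha>. \<alpha> \<in> exponents n d}
      \<union> {var (C \<alpha>) * var (X i) | \<alpha> i. \<alpha> \<in> exponents n d \<and> i < n}"

definition uniform_det_rep :: "nat \<Rightarrow> nat \<Rightarrow> nat \<Rightarrow> 'k::field gpoly mat \<Rightarrow> bool" where
  "uniform_det_rep n d N M \<longleftrightarrow>
    M \<in> carrier_mat N N \<and>
    (\<forall>i<N. \<forall>j<N. M $$ (i, j) \<in> gpoly.span (entry_monomials n d)) \<and>
    det M = generic_poly n d"

text \<open>
  The minimum is taken in \<^typ>\<open>enat\<close>, so that a finite value is always attained (it would be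
  \<open>\<infinity>\<close> if there were no representation at all). The first argument fixes the field.
\<close>

definition Nstar :: "'k::field itself \<Rightarrow> nat \<Rightarrow> nat \<Rightarrow> enat" where
  "Nstar K n d = (INF N \<in> {N. \<exists>M :: 'k gpoly mat. uniform_det_rep n d N M}. enat N)"

text \<open>So the sum in \<^const>\<open>generic_poly\<close> is a genuine finite sum (infinite sums default to \<open>0\<close>).\<close>

lemma finite_exponents: "finite (exponents n d)"
proof (rule finite_subset)
  show "exponents n d \<subseteq> {\<alpha>. set \<alpha> \<subseteq> {..d} \<and> length \<alpha> = n}"
    using member_le_sum_list by (fastforce simp: exponents_def)
  show "finite {\<alpha>. set \<alpha> \<subseteq> {..d} \<and> length \<alpha> = n}"
    by (rule finite_lists_length_eq) simp
qed

end

theory Submission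
  imports Defs
begin

text \<open>
  Size 3 is attained by a matrix whose first two rows \<open>(-x\<^sub>1, 1, 0)\<close> and \<open>(-x\<^sub>2, 0, 1)\<close> are
  orthogonal to \<open>(1, x\<^sub>1, x\<^sub>2)\<close>: the determinant is then the scalar product of the third row with
  \<open>(1, x\<^sub>1, x\<^sub>2)\<close>, and the third row can be chosen to make it the generic quadric (\<open>det_rep3\<close>).

  Sizes 0 and 1 are impossible because neither \<open>1\<close> nor a matrix entry can contain a monomial
  \<open>c\<^sub>\<alpha> x\<^sub>1\<^sup>2\<close>. For size 2 write \<open>M = A + \<Sum>\<^sub>\<alpha> c\<^sub>\<alpha> B\<^sub>\<alpha>\<close>, where the entries of \<open>A\<close> and of the \<open>B\<^sub>\<alpha>\<close> are
  polynomials of degree at most 1 in \<open>x\<^sub>1, x\<^sub>2\<close>. Comparing coefficients in \<open>det M = p\<^bsub>2,2\<^esub>\<close> gives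
  \<open>det A = 0\<close> and
  \<open>a\<^sub>1\<^sub>1 b\<^sub>2\<^sub>2 + a\<^sub>2\<^sub>2 b\<^sub>1\<^sub>1 - a\<^sub>1\<^sub>2 b\<^sub>2\<^sub>1 - a\<^sub>2\<^sub>1 b\<^sub>1\<^sub>2 = x\<^sup>\<alpha>\<close>
  for every \<open>\<alpha>\<close>, where \<open>b\<close> stands for \<open>B\<^sub>\<alpha>\<close>. Homogenize with a third variable \<open>x\<^sub>0\<close>, so that the
  entries become linear forms in three variables. From \<open>a\<^sub>1\<^sub>1 a\<^sub>2\<^sub>2 = a\<^sub>1\<^sub>2 a\<^sub>2\<^sub>1\<close> it follows, as linear
  forms are prime, that the four entries of \<open>A\<close> span a space of dimension at most 2; hence they
  have a common zero \<open>P \<noteq> 0\<close> in \<open>K\<^sup>3\<close> (\<open>singular_forms_common_zero\<close>). Therefore all the quadrics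
  \<open>x\<^sup>\<alpha>\<close> vanish at \<open>P\<close>; but \<open>x\<^sub>k\<^sup>2\<close> is among them, and it does not vanish at \<open>P\<close> if \<open>P\<^sub>k \<noteq> 0\<close>.

  As \<open>K\<close> may be finite or of characteristic 2, identities between quadrics are always read
  coefficientwise, never as identities of functions.
\<close>

section \<open>Products of linear forms\<close>

text \<open>
  A linear form is given by its coefficients \<open>u\<^sub>0, u\<^sub>1, \<dots>\<close>. Then \<open>form_mult u v i j\<close> is the
  coefficient of the monomial \<open>x\<^sub>i x\<^sub>j\<close> in the product of the forms \<open>u\<close> and \<open>v\<close>.
\<close>
definition form_mult :: "(nat \<Rightarrow> 'a::semiring_0) \<Rightarrow> (nat \<Rightarrow> 'a) \<Rightarrow> nat \<Rightarrow> nat \<Rightarrow> 'a" where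
  "form_mult u v i j = (if i = j then u i * v i else u i * v j + u j * v i)"

text \<open>Evaluation at a point \<open>P\<close> is multiplicative; each monomial is counted once, with \<open>j \<le> i\<close>.\<close>
lemma sum_form_mult:
  fixes u v P :: "nat \<Rightarrow> 'a::comm_semiring_0"
  shows "(\<Sum>i<n. \<Sum>j\<le>i. form_mult u v i j * (P i * P j)) = (\<Sum>i<n. u i * P i) * (\<Sum>i<n. v i * P i)"
proof (induction n)
  case 0
  then show ?case by simp
next
  case (Suc n)
  have "(\<Sum>j\<le>n. form_mult u v n j * (P n * P j)) =
      (\<Sum>j<n. u n * P n * (v j * P j) + v n * P n * (u j * P j)) + u n * v n * (P n * P n)"
    unfolding lessThan_Suc_atMost [symmetric]
    by (simp add: form_mult_def algebra_simps cong: sum.cong_simp)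
  also have "\<dots> = u n * P n * (\<Sum>j<n. v j * P j) + v n * P n * (\<Sum>j<n. u j * P j) + u n * P n * (v n * P n)"
    by (simp add: sum.distrib sum_distrib_left algebra_simps)
  finally show ?case
    using Suc by (simp add: algebra_simps)
qed

text \<open>The ring of polynomials has no zero divisors among the linear forms.\<close>
lemma form_mult_eq_0:
  fixes u v :: "nat \<Rightarrow> 'a::field"
  assumes "\<And>i j. i < n \<Longrightarrow> j < n \<Longrightarrow> form_mult u v i j = 0"
  shows "(\<forall>i<n. u i = 0) \<or> (\<forall>i<n. v i = 0)"
proof (rule ccontr)
  assume "\<not> ?thesis"
  then obtain i j where ij: "i < n" "u i \<noteq> 0" "j < n" "v j \<noteq> 0" by blast
  have "v i = 0" "u j = 0"
    using assms [of i i] assms [of j j] ij by (simp_all add: form_mult_def)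
  then show False
    using assms [of i j] ij by (auto simp: form_mult_def split: if_splits)
qed

text \<open>
  A nonzero linear form \<open>a\<close> is prime: if it divides \<open>b c\<close>, then it divides \<open>b\<close> or \<open>c\<close>. Subtracting
  multiples of \<open>a\<close> removes \<open>x\<^sub>k\<close> from \<open>b\<close> and from \<open>c\<close>; as \<open>x\<^sub>k\<close> occurs in \<open>a\<close>, the new quotient
  has to be \<open>0\<close>.
\<close>
lemma form_mult_dvd:
  fixes a b c d :: "nat \<Rightarrow> 'a::field"
  assumes eq: "\<And>i j. i < n \<Longrightarrow> j < n \<Longrightarrow> form_mult a d i j = form_mult b c i j"
    and k: "k < n" "a k \<noteq> 0"
  shows "(\<exists>l. \<forall>i<n. b i = l * a i) \<or> (\<exists>l. \<forall>i<n. c i = l * a i)"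
proof -
  define l m where "l = b k / a k" and "m = c k / a k"
  define b' c' where "b' i = b i - l * a i" and "c' i = c i - m * a i" for i
  define d' where "d' i = d i - l * c i - m * b i + l * m * a i" for i
  have eq': "form_mult a d' i j = form_mult b' c' i j" if "i < n" "j < n" for i j
    using eq [OF that] by (simp add: form_mult_def b'_def c'_def d'_def algebra_simps split: if_splits)
  have bk: "b' k = 0" "c' k = 0"
    using k by (simp_all add: b'_def c'_def l_def m_def)
  have dk: "d' k = 0"
    using eq' [OF k(1) k(1)] k bk by (simp add: form_mult_def)
  have d0: "d' i = 0" if "i < n" for i
    using eq' [OF k(1) that] k bk dk by (auto simp: form_mult_def split: if_splits)
  have "form_mult b' c' i j = 0" if "i < n" "j < n" for i j
    using eq' [OF that] d0 that by (simp add: form_mult_def split: if_splits)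
  then have "(\<forall>i<n. b' i = 0) \<or> (\<forall>i<n. c' i = 0)"
    by (rule form_mult_eq_0)
  then show ?thesis
    unfolding b'_def c'_def by (metis eq_iff_diff_eq_0)
qed

text \<open>Two linear forms in three variables have a common zero other than the origin.\<close>
lemma two_forms_common_zero:
  fixes u v :: "nat \<Rightarrow> 'a::field"
  obtains P :: "nat \<Rightarrow> 'a" and k where "k < 3" "P k \<noteq> 0"
    "(\<Sum>i<3. u i * P i) = 0" "(\<Sum>i<3. v i * P i) = 0"
proof -
  \<comment> \<open>The zero row makes this matrix singular; a kernel vector is the required point.\<close>
  define A where "A = mat 3 3 (\<lambda>(i, j). if i = 0 then u j else if i = 1 then v j else 0)"
  have A: "A \<in> carrier_mat 3 3" by (simp add: A_def)
  have "det A = (\<Sum>j<3. A $$ (2, j) * cofactor A 2 j)"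
    by (rule laplace_expansion_row [OF A]) simp
  also have "\<dots> = 0" by (simp add: A_def)
  finally obtain w where w: "w \<in> carrier_vec 3" "w \<noteq> 0\<^sub>v 3" "A *\<^sub>v w = 0\<^sub>v 3"
    using det_0_iff_vec_prod_zero_field [OF A] by blast
  have row: "(\<Sum>j<3. A $$ (i, j) * w $ j) = 0" if "i < 3" for i
  proof -
    have "(A *\<^sub>v w) $ i = 0" using w(3) that by simp
    then show ?thesis
      using that A w(1) by (simp add: scalar_prod_def lessThan_atLeast0)
  qed
  obtain k where "k < 3" "w $ k \<noteq> 0"
    using w(1,2) by (metis carrier_vecD eq_vecI index_zero_vec)
  moreover have "(\<Sum>i<3. u i * w $ i) = 0" "(\<Sum>i<3. v i * w $ i) = 0"
    using row [of 0] row [of 1] by (simp_all add: A_def)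
  ultimately show ?thesis using that by blast
qed

text \<open>
  The four entries of a singular \<open>2 \<times> 2\<close> matrix of linear forms in three variables have a common
  zero other than the origin: all of them are linear combinations of two of them.
\<close>
lemma singular_forms_common_zero:
  fixes a b c d :: "nat \<Rightarrow> 'a::field"
  assumes eq: "\<And>i j. i < 3 \<Longrightarrow> j < 3 \<Longrightarrow> form_mult a d i j = form_mult b c i j"
  obtains P :: "nat \<Rightarrow> 'a" and k where "k < 3" "P k \<noteq> 0"
    "(\<Sum>i<3. a i * P i) = 0" "(\<Sum>i<3. b i * P i) = 0"
    "(\<Sum>i<3. c i * P i) = 0" "(\<Sum>i<3. d i * P i) = 0"
proof -
  have scaled: "(\<Sum>i<3. v i * P i) = 0"
    if "\<forall>i<3. v i = l * u i" "(\<Sum>i<3. u i * P i) = 0" for u v P :: "nat \<Rightarrow> 'a" and l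
  proof -
    have "(\<Sum>i<3. v i * P i) = l * (\<Sum>i<3. u i * P i)"
      using that(1) by (simp add: sum_distrib_left mult.assoc)
    then show ?thesis using that(2) by simp
  qed
  have cancel: "\<exists>l. \<forall>i<3. d i = l * v i"
    if eq': "\<And>i j. i < 3 \<Longrightarrow> j < 3 \<Longrightarrow> form_mult a d i j = form_mult u v i j"
      and l: "\<forall>i<3. u i = l * a i" and k: "k < 3" "a k \<noteq> 0" for u v k l
  proof -
    have "form_mult a (\<lambda>i. d i - l * v i) i j = 0" if "i < 3" "j < 3" for i j
      using eq' [OF that] l that by (simp add: form_mult_def algebra_simps split: if_splits)
    then have "(\<forall>i<3. a i = 0) \<or> (\<forall>i<3. d i - l * v i = 0)"
      by (rule form_mult_eq_0)
    then show ?thesis using k by auto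
  qed
  consider "\<forall>i<3. a i = 0" "\<forall>i<3. b i = 0" | "\<forall>i<3. a i = 0" "\<forall>i<3. c i = 0"
    | k l where "k < 3" "a k \<noteq> 0" "\<forall>i<3. b i = l * a i"
    | k l where "k < 3" "a k \<noteq> 0" "\<forall>i<3. c i = l * a i"
  proof (cases "\<forall>i<3. a i = 0")
    case True
    then have "form_mult b c i j = 0" if "i < 3" "j < 3" for i j
      using eq [OF that] that by (simp add: form_mult_def split: if_splits)
    then have "(\<forall>i<3. b i = 0) \<or> (\<forall>i<3. c i = 0)"
      by (rule form_mult_eq_0)
    then show ?thesis using True that by blast
  next
    case False
    then obtain k where "k < 3" "a k \<noteq> 0" by blast
    then show ?thesis using form_mult_dvd [OF eq] that by blast
  qed
  then show ?thesis
  proof cases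
    case 1
    obtain P k where P: "k < 3" "P k \<noteq> 0" "(\<Sum>i<3. c i * P i) = 0" "(\<Sum>i<3. d i * P i) = 0"
      by (rule two_forms_common_zero)
    show ?thesis by (rule that [of k P]) (use 1 P in simp_all)
  next
    case 2
    obtain P k where P: "k < 3" "P k \<noteq> 0" "(\<Sum>i<3. b i * P i) = 0" "(\<Sum>i<3. d i * P i) = 0"
      by (rule two_forms_common_zero)
    show ?thesis by (rule that [of k P]) (use 2 P in simp_all)
  next
    case (3 k l)
    obtain P k' where P: "k' < 3" "P k' \<noteq> 0" "(\<Sum>i<3. a i * P i) = 0" "(\<Sum>i<3. c i * P i) = 0"
      by (rule two_forms_common_zero)
    obtain m where "\<forall>i<3. d i = m * c i"
      using cancel [OF eq 3(3,1,2)] by blast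
    then show ?thesis
      using that [OF P(1-3)] scaled [OF 3(3) P(3)] scaled P(4) by blast
  next
    case (4 k l)
    obtain P k' where P: "k' < 3" "P k' \<noteq> 0" "(\<Sum>i<3. a i * P i) = 0" "(\<Sum>i<3. b i * P i) = 0"
      by (rule two_forms_common_zero)
    have "form_mult a d i j = form_mult c b i j" if "i < 3" "j < 3" for i j
      using eq [OF that] by (simp add: form_mult_def algebra_simps)
    then obtain m where "\<forall>i<3. d i = m * b i"
      using cancel [OF _ 4(3,1,2)] by blast
    then show ?thesis
      using that [OF P(1-4)] scaled [OF 4(3) P(3)] scaled P(4) by blast
  qed
qed

section \<open>Monomials of the entries and of their products\<close>

text \<open>
  The monomials \<open>1, x\<^sub>1, x\<^sub>2, \<dots>\<close>, numbered from \<open>0\<close>: \<open>xmon 0\<close> is \<open>1\<close>, the dehomogenization of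
  \<open>x\<^sub>0\<close>, and \<open>xmon (Suc i)\<close> is the variable \<open>X i\<close>. Monomials are exponent functions, so their
  product is written as a sum.
\<close>
definition xmon :: "nat \<Rightarrow> gvar \<Rightarrow>\<^sub>0 nat" where
  "xmon i = (if i = 0 then 0 else Poly_Mapping.single (X (i - 1)) 1)"

text \<open>The monomials \<open>1\<close> (for \<^const>\<open>None\<close>) and \<open>c\<^sub>\<alpha>\<close> (for \<open>Some \<alpha>\<close>).\<close>
definition cmon :: "nat list option \<Rightarrow> gvar \<Rightarrow>\<^sub>0 nat" where
  "cmon w = (case w of None \<Rightarrow> 0 | Some \<alpha> \<Rightarrow> Poly_Mapping.single (C \<alpha>) 1)"

lemma cmon_None: "cmon None = 0"
  by (simp add: cmon_def)

lemma lookup_xmon: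
  "Poly_Mapping.lookup (xmon i) (X k) = (if i = Suc k then 1 else 0)"
  "Poly_Mapping.lookup (xmon i) (C \<alpha>) = 0"
  by (auto simp: xmon_def lookup_single)

lemma lookup_cmon:
  "Poly_Mapping.lookup (cmon w) (X k) = 0"
  "Poly_Mapping.lookup (cmon w) (C \<alpha>) = (if w = Some \<alpha> then 1 else 0)"
  by (auto simp: cmon_def lookup_single split: option.splits)

text \<open>A monomial determines its factor in the coefficient variables and its factor in the \<open>x\<^sub>i\<close>.\<close>
lemma cmon_add_cancel:
  assumes "cmon w + m = cmon w' + m'"
    and "\<And>\<alpha>. Poly_Mapping.lookup m (C \<alpha>) = 0" "\<And>\<alpha>. Poly_Mapping.lookup m' (C \<alpha>) = 0"
  shows "w = w' \<and> m = m'"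
proof -
  have *: "(w = Some \<alpha>) = (w' = Some \<alpha>)" for \<alpha>
    using arg_cong [OF assms(1), of "\<lambda>p. Poly_Mapping.lookup p (C \<alpha>)"] assms(2,3)
    by (simp add: lookup_add lookup_cmon split: if_splits)
  have "w = w'"
    using * [of "the w"] * [of "the w'"] by (cases w; cases w') simp_all
  then show ?thesis using assms(1) by simp
qed

lemma cmon_add_eq:
  assumes "cmon w + cmon w' = cmon z"
  shows "w = None \<and> w' = z \<or> w = z \<and> w' = None"
proof -
  have inj: "u = u'" if "cmon u = cmon u'" for u u'
    using cmon_add_cancel [of u 0 u' 0] that by simp
  show ?thesis
  proof (cases w)
    case None
    then have "cmon w' = cmon z" using assms by (simp add: cmon_def)
    then show ?thesis using inj None by blast
  next
    case (Some \<alpha>)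
    have "z = w"
      using arg_cong [OF assms, of "\<lambda>p. Poly_Mapping.lookup p (C \<alpha>)"] Some
      by (simp add: lookup_add lookup_cmon split: if_splits)
    then have "cmon w' = cmon None" using assms by (simp add: cmon_def)
    then show ?thesis using inj \<open>z = w\<close> by blast
  qed
qed

lemma xmon_inj:
  assumes "xmon v = xmon i"
  shows "v = i"
proof -
  have *: "v = Suc k \<longleftrightarrow> i = Suc k" for k
    using arg_cong [OF assms, of "\<lambda>p. Poly_Mapping.lookup p (X k)"] by (simp add: lookup_xmon split: if_splits)
  show ?thesis
    using * [of "v - 1"] * [of "i - 1"] by (cases v; cases i) simp_all
qed

text \<open>
  Dehomogenization loses nothing in degree 2: a product \<open>x\<^sub>i x\<^sub>j\<close> with \<open>x\<^sub>0 = 1\<close> determines \<open>i\<close> and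
  \<open>j\<close> up to order.
\<close>
lemma xmon_add_eq:
  assumes "xmon v + xmon v' = xmon i + xmon j"
  shows "v = i \<and> v' = j \<or> v = j \<and> v' = i"
proof -
  have *: "(if v = Suc k then 1 else 0) + (if v' = Suc k then 1 else 0) =
      (if i = Suc k then 1 else 0) + (if j = Suc k then 1 else (0::nat))" for k
    using arg_cong [OF assms, of "\<lambda>p. Poly_Mapping.lookup p (X k)"] by (simp add: lookup_add lookup_xmon)
  have "v = i \<or> v = j"
  proof (rule ccontr)
    assume ne: "\<not> (v = i \<or> v = j)"
    have "v = 0"
    proof (rule ccontr)
      assume "v \<noteq> 0"
      then have "v = Suc (v - 1)" by simp
      then show False using * [of "v - 1"] ne by simp
    qed
    then have "i = Suc (i - 1)" "j = Suc (j - 1)" using ne by simp_all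
    then show False
      using * [of "i - 1"] * [of "j - 1"] \<open>v = 0\<close> by (simp split: if_splits)
  qed
  then show ?thesis
  proof
    assume "v = i"
    then have "xmon v' = xmon j" using assms by simp
    then show ?thesis using \<open>v = i\<close> xmon_inj by blast
  next
    assume "v = j"
    then have "xmon v' = xmon i" using assms by (simp add: add.commute [of "xmon i"])
    then show ?thesis using \<open>v = j\<close> xmon_inj by blast
  qed
qed

text \<open>The ways to factor \<open>c x\<^sub>i x\<^sub>j\<close>, with \<open>c = 1\<close> or \<open>c = c\<^sub>\<alpha>\<close>, into monomials of two entries.\<close>
lemma monomial_factorization:
  assumes "(cmon w + xmon v) + (cmon w' + xmon v') = cmon z + (xmon i + xmon j)"
  shows "(w = None \<and> w' = z \<or> w = z \<and> w' = None) \<and> (v = i \<and> v' = j \<or> v = j \<and> v' = i)"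
proof -
  have eqC: "Poly_Mapping.lookup (cmon w + cmon w') (C \<alpha>) = Poly_Mapping.lookup (cmon z) (C \<alpha>)" for \<alpha>
    using arg_cong [OF assms, of "\<lambda>p. Poly_Mapping.lookup p (C \<alpha>)"]
    by (simp add: lookup_add lookup_xmon)
  have eqX: "Poly_Mapping.lookup (xmon v + xmon v') (X k) = Poly_Mapping.lookup (xmon i + xmon j) (X k)" for k
    using arg_cong [OF assms, of "\<lambda>p. Poly_Mapping.lookup p (X k)"]
    by (simp add: lookup_add lookup_cmon)
  have "cmon w + cmon w' = cmon z"
  proof (rule poly_mapping_eqI)
    show "Poly_Mapping.lookup (cmon w + cmon w') g = Poly_Mapping.lookup (cmon z) g" for g
      using eqC by (cases g) (simp_all add: lookup_add lookup_cmon)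
  qed
  moreover have "xmon v + xmon v' = xmon i + xmon j"
  proof (rule poly_mapping_eqI)
    show "Poly_Mapping.lookup (xmon v + xmon v') g = Poly_Mapping.lookup (xmon i + xmon j) g" for g
      using eqX by (cases g) (simp_all add: lookup_add lookup_xmon)
  qed
  ultimately show ?thesis using cmon_add_eq xmon_add_eq by blast
qed

lemma cmon_xmon_inj: "cmon w + xmon v = cmon w' + xmon v' \<longleftrightarrow> w = w' \<and> v = v'"
proof
  assume *: "cmon w + xmon v = cmon w' + xmon v'"
  then have "w = w' \<and> xmon v = xmon v'"
    by (rule cmon_add_cancel) (simp_all add: lookup_xmon)
  then show "w = w' \<and> v = v'"
    using xmon_add_eq [of v 0 v' 0] by auto
qed simp

lemma keys_entry:
  fixes p :: "'k::field gpoly"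
  assumes "p \<in> gpoly.span (entry_monomials n d)"
  shows "Poly_Mapping.keys p \<subseteq> {cmon w + xmon v | w v. True}"
  using assms
proof (induction rule: gpoly.span_induct_alt)
  case base
  then show ?case by simp
next
  case (step c x y)
  have one: "(1 :: 'k gpoly) = Poly_Mapping.single (cmon None + xmon 0) 1"
    by (simp add: cmon_def xmon_def flip: single_one)
  have vX: "(var (X i) :: 'k gpoly) = Poly_Mapping.single (cmon None + xmon (Suc i)) 1" for i
    by (simp add: cmon_def xmon_def var_def)
  have vC: "(var (C \<alpha>) :: 'k gpoly) = Poly_Mapping.single (cmon (Some \<alpha>) + xmon 0) 1" for \<alpha>
    by (simp add: cmon_def xmon_def var_def)
  have vCX: "(var (C \<alpha>) * var (X i) :: 'k gpoly) = Poly_Mapping.single (cmon (Some \<alpha>) + xmon (Suc i)) 1" for \<alpha> i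
    by (simp add: cmon_def xmon_def var_def mult_single)
  have "\<exists>w v. x = Poly_Mapping.single (cmon w + xmon v) 1"
    using step(1) unfolding entry_monomials_def
    by (elim UnE CollectE exE conjE singletonE) (use one vX vC vCX in \<open>fast+\<close>)
  then obtain w v where x: "x = Poly_Mapping.single (cmon w + xmon v) 1" by blast
  have "Poly_Mapping.keys (gscale c x) \<subseteq> {cmon w + xmon v}"
    by (simp add: x gscale_def mult_single)
  then have "Poly_Mapping.keys (gscale c x) \<subseteq> {cmon w + xmon v | w v. True}" by blast
  then show ?case using step(2) keys_add [of "gscale c x" y] by blast
qed

text \<open>
  A coefficient of a product of polynomials can be computed from any finite set \<open>D\<close> of
  factorizations of the monomial, provided that it contains all those that contribute.
\<close>
lemma lookup_mult_sum:
  fixes p q :: "'a::monoid_add \<Rightarrow>\<^sub>0 'b::semiring_0"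
  assumes "finite D" "\<And>l l'. (l, l') \<in> D \<Longrightarrow> l + l' = n"
    and "\<And>l l'. l \<in> Poly_Mapping.keys p \<Longrightarrow> l' \<in> Poly_Mapping.keys q \<Longrightarrow> l + l' = n \<Longrightarrow> (l, l') \<in> D"
  shows "Poly_Mapping.lookup (p * q) n =
    (\<Sum>(l, l')\<in>D. Poly_Mapping.lookup p l * Poly_Mapping.lookup q l')"
proof -
  have "Poly_Mapping.lookup (p * q) n =
      (\<Sum>(l, l'). Poly_Mapping.lookup p l * Poly_Mapping.lookup q l' when n = l + l')"
    by (simp add: times_poly_mapping.rep_eq prod_fun_unfold_prod)
  also have "\<dots> = (\<Sum>(l, l')\<in>D. Poly_Mapping.lookup p l * Poly_Mapping.lookup q l' when n = l + l')"
  proof (rule Sum_any.expand_superset [OF assms(1)], clarify)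
    fix l l'
    assume "(Poly_Mapping.lookup p l * Poly_Mapping.lookup q l' when n = l + l') \<noteq> 0"
    then have "Poly_Mapping.lookup p l \<noteq> 0" "Poly_Mapping.lookup q l' \<noteq> 0" "l + l' = n"
      by (auto simp: when_def split: if_splits)
    then show "(l, l') \<in> D"
      using assms(3) by (simp add: in_keys_iff)
  qed
  also have "\<dots> = (\<Sum>(l, l')\<in>D. Poly_Mapping.lookup p l * Poly_Mapping.lookup q l')"
    by (rule sum.cong) (use assms(2) in auto)
  finally show ?thesis .
qed

text \<open>
  For a matrix entry \<open>p\<close>, \<open>coeff_form p None\<close> is the part of \<open>p\<close> without coefficient variables and
  \<open>coeff_form p (Some \<alpha>)\<close> is the coefficient of \<open>c\<^sub>\<alpha>\<close>; both are polynomials of degree at most 1 in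
  the \<open>x\<^sub>i\<close>, given as homogenized linear forms.
\<close>
definition coeff_form :: "'k::field gpoly \<Rightarrow> nat list option \<Rightarrow> nat \<Rightarrow> 'k" where
  "coeff_form p w i = Poly_Mapping.lookup p (cmon w + xmon i)"

text \<open>
  The index set has fewer than four elements if \<open>i = j\<close> or \<open>z = None\<close>: equal factorizations must be
  counted only once.
\<close>
lemma lookup_entry_mult:
  fixes p q :: "'k::field gpoly"
  assumes p: "p \<in> gpoly.span (entry_monomials n d)" and q: "q \<in> gpoly.span (entry_monomials n d)"
  shows "Poly_Mapping.lookup (p * q) (cmon z + (xmon i + xmon j)) =
    (\<Sum>((w, v), (w', v'))\<in>{((None, i), (z, j)), ((None, j), (z, i)), ((z, i), (None, j)), ((z, j), (None, i))}.
      coeff_form p w v * coeff_form q w' v')" (is "_ = sum ?g ?D")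
proof -
  define m where "m = (\<lambda>(w, v). cmon w + xmon v)"
  have inj: "inj m" by (auto simp: m_def inj_on_def cmon_xmon_inj)
  have "Poly_Mapping.lookup (p * q) (cmon z + (xmon i + xmon j)) =
      (\<Sum>(l, l')\<in>map_prod m m ` ?D. Poly_Mapping.lookup p l * Poly_Mapping.lookup q l')"
  proof (rule lookup_mult_sum)
    fix l l'
    assume l: "l \<in> Poly_Mapping.keys p" "l' \<in> Poly_Mapping.keys q" "l + l' = cmon z + (xmon i + xmon j)"
    obtain w v w' v' where lw: "l = cmon w + xmon v" "l' = cmon w' + xmon v'"
      using l(1,2) keys_entry [OF p] keys_entry [OF q] by blast
    have "((w, v), (w', v')) \<in> ?D"
      using monomial_factorization [OF l(3) [unfolded lw]] by (elim conjE disjE) simp_all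
    then have "map_prod m m ((w, v), (w', v')) \<in> map_prod m m ` ?D" by (rule imageI)
    then show "(l, l') \<in> map_prod m m ` ?D" by (simp only: lw m_def map_prod_simp prod.case)
  next
    fix l l'
    assume "(l, l') \<in> map_prod m m ` ?D"
    then show "l + l' = cmon z + (xmon i + xmon j)"
      by (elim imageE insertE emptyE) (simp_all add: m_def cmon_None ac_simps)
  qed simp
  also have "\<dots> = sum ?g ?D"
  proof (subst sum.reindex)
    show "inj_on (map_prod m m) ?D"
      by (rule inj_on_subset [OF prod.inj_map [OF inj inj]]) simp
    have "(\<lambda>(l, l'). Poly_Mapping.lookup p l * Poly_Mapping.lookup q l') \<circ> map_prod m m = ?g"
      by (auto simp: fun_eq_iff m_def coeff_form_def)
    then show "sum ((\<lambda>(l, l'). Poly_Mapping.lookup p l * Poly_Mapping.lookup q l') \<circ> map_prod m m) ?D = sum ?g ?D"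
      by (rule arg_cong)
  qed
  finally show ?thesis .
qed

lemma lookup_entry_mult_None:
  fixes p q :: "'k::field gpoly"
  assumes "p \<in> gpoly.span (entry_monomials n d)" "q \<in> gpoly.span (entry_monomials n d)"
  shows "Poly_Mapping.lookup (p * q) (cmon None + (xmon i + xmon j)) =
    form_mult (coeff_form p None) (coeff_form q None) i j"
proof -
  have "{((None, i), (None, j)), ((None, j), (None, i)), ((None, i), (None, j)), ((None, j), (None, i))} =
      {((None :: nat list option, i), (None :: nat list option, j)), ((None, j), (None, i))}"
    by (simp add: insert_commute)
  then show ?thesis
    unfolding lookup_entry_mult [OF assms] by (cases "i = j") (simp_all add: form_mult_def)
qed

lemma lookup_entry_mult_Some:
  fixes p q :: "'k::field gpoly"
  assumes "p \<in> gpoly.span (entry_monomials n d)" "q \<in> gpoly.span (entry_monomials n d)"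
  shows "Poly_Mapping.lookup (p * q) (cmon (Some \<alpha>) + (xmon i + xmon j)) =
    form_mult (coeff_form p None) (coeff_form q (Some \<alpha>)) i j +
    form_mult (coeff_form p (Some \<alpha>)) (coeff_form q None) i j"
proof (cases "i = j")
  case True
  have "{((None, j), (Some \<alpha>, j)), ((None, j), (Some \<alpha>, j)), ((Some \<alpha>, j), (None, j)), ((Some \<alpha>, j), (None, j))} =
      {((None, j), (Some \<alpha>, j)), ((Some \<alpha>, j), (None, j))}"
    by simp
  then show ?thesis
    unfolding lookup_entry_mult [OF assms] True by (simp add: form_mult_def)
next
  case False
  then show ?thesis
    unfolding lookup_entry_mult [OF assms] by (simp add: form_mult_def add.assoc)
qed

section \<open>The generic polynomial\<close>

text \<open>The monomial \<open>x\<^sup>\<alpha>\<close>.\<close>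
definition xpow :: "nat list \<Rightarrow> gvar \<Rightarrow>\<^sub>0 nat" where
  "xpow \<alpha> = (\<Sum>i<length \<alpha>. Poly_Mapping.single (X i) (\<alpha> ! i))"

lemma lookup_xpow_C: "Poly_Mapping.lookup (xpow \<alpha>) (C \<beta>) = 0"
  by (simp add: xpow_def lookup_sum lookup_single)

lemma generic_poly_eq:
  "generic_poly n d = (\<Sum>\<alpha>\<in>exponents n d. Poly_Mapping.single (cmon (Some \<alpha>) + xpow \<alpha>) (1::'k::field))"
  unfolding generic_poly_def
proof (rule sum.cong [OF refl])
  fix \<alpha> assume "\<alpha> \<in> exponents n d"
  then have n: "n = length \<alpha>" by (simp add: exponents_def)
  have pow: "var (X i) ^ k = Poly_Mapping.single (Poly_Mapping.single (X i) k) (1::'k)" for i k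
    by (induction k) (simp_all add: var_def mult_single flip: single_add)
  have "(\<Prod>i\<in>I. var (X i) ^ (\<alpha> ! i)) =
      Poly_Mapping.single (\<Sum>i\<in>I. Poly_Mapping.single (X i) (\<alpha> ! i)) (1::'k)" for I
    by (induction I rule: infinite_finite_induct) (simp_all add: pow mult_single)
  then show "var (C \<alpha>) * (\<Prod>i<n. var (X i) ^ (\<alpha> ! i)) =
      Poly_Mapping.single (cmon (Some \<alpha>) + xpow \<alpha>) (1::'k)"
    by (simp add: n xpow_def var_def cmon_def mult_single)
qed

lemma lookup_generic_poly:
  assumes "\<And>\<alpha>. Poly_Mapping.lookup m (C \<alpha>) = 0"
  shows "Poly_Mapping.lookup (generic_poly n d) (cmon w + m) =
    (case w of None \<Rightarrow> 0 | Some \<alpha> \<Rightarrow> if \<alpha> \<in> exponents n d \<and> xpow \<alpha> = m then 1 else (0::'k::field))"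
proof -
  have "cmon (Some \<alpha>) + xpow \<alpha> = cmon w + m \<longleftrightarrow> Some \<alpha> = w \<and> xpow \<alpha> = m" for \<alpha>
    using cmon_add_cancel [of "Some \<alpha>" "xpow \<alpha>" w m] assms lookup_xpow_C by auto
  then have "Poly_Mapping.lookup (generic_poly n d) (cmon w + m) =
      (\<Sum>\<alpha>\<in>exponents n d. if Some \<alpha> = w \<and> xpow \<alpha> = m then 1 else (0::'k))"
    by (simp add: generic_poly_eq lookup_sum lookup_single when_def)
  also have "\<dots> = (\<Sum>\<alpha>\<in>exponents n d. case w of None \<Rightarrow> 0 |
      Some \<beta> \<Rightarrow> if \<alpha> = \<beta> then (if xpow \<beta> = m then 1 else 0) else 0)"
    by (rule sum.cong) (auto split: option.splits)
  finally show ?thesis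
    by (cases w) (simp_all add: finite_exponents)
qed

lemma lookup_generic_poly_xmon:
  "Poly_Mapping.lookup (generic_poly n d) (cmon w + (xmon i + xmon j)) =
    (case w of None \<Rightarrow> 0 |
      Some \<alpha> \<Rightarrow> if \<alpha> \<in> exponents n d \<and> xpow \<alpha> = xmon i + xmon j then 1 else (0::'k::field))"
  by (rule lookup_generic_poly) (simp add: lookup_add lookup_xmon)

text \<open>
  The squares of \<open>x\<^sub>0 = 1\<close>, \<open>x\<^sub>1\<close> and \<open>x\<^sub>2\<close> are among the monomials \<open>x\<^sup>\<alpha>\<close> with \<open>|\<alpha>| \<le> 2\<close> in two
  variables.
\<close>
lemma ex_square_exponent:
  assumes "k < 3"
  obtains \<alpha> where "\<alpha> \<in> exponents 2 2" "xpow \<alpha> = xmon k + xmon k"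
proof -
  have *: "xpow [a, b] = Poly_Mapping.single (X 0) a + Poly_Mapping.single (X 1) b" for a b
    by (simp add: xpow_def numeral_2_eq_2)
  consider "k = 0" | "k = 1" | "k = 2" using assms by linarith
  then show ?thesis
  proof cases
    case 1
    then show ?thesis
      by (intro that [of "[0, 0]"]) (simp_all add: exponents_def * xmon_def)
  next
    case 2
    then show ?thesis
      by (intro that [of "[2, 0]"]) (simp_all add: exponents_def * xmon_def numeral_2_eq_2 flip: single_add)
  next
    case 3
    then show ?thesis
      by (intro that [of "[0, 2]"]) (simp_all add: exponents_def * xmon_def numeral_2_eq_2 flip: single_add)
  qed
qed

section \<open>Representations of size at most three\<close>

lemma det_2x2:
  assumes "A \<in> carrier_mat 2 2"
  shows "det A = A $$ (0, 0) * A $$ (1, 1) - A $$ (0, 1) * A $$ (1, 0)"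
proof -
  have *: "det (mat_delete A i 0) = A $$ (1 - i, 1)" if "i < 2" for i
  proof -
    have "det (mat_delete A i 0) = mat_delete A i 0 $$ (0, 0)"
      by (rule det_single) (use assms in \<open>auto simp: mat_delete_def\<close>)
    then show ?thesis using that assms by (auto simp: mat_delete_def less_2_cases_iff)
  qed
  show ?thesis
    unfolding laplace_expansion_column [OF assms, of 0, simplified]
    by (simp add: numeral_2_eq_2 cofactor_def * algebra_simps)
qed

lemma no_uniform_det_rep_2:
  fixes M :: "'k::field gpoly mat"
  shows "\<not> uniform_det_rep 2 2 2 M"
proof
  assume "uniform_det_rep 2 2 2 M"
  then have M: "M \<in> carrier_mat 2 2" and det: "det M = generic_poly 2 2"
    and span: "\<And>i j. i < 2 \<Longrightarrow> j < 2 \<Longrightarrow> M $$ (i, j) \<in> gpoly.span (entry_monomials 2 2)"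
    by (auto simp: uniform_det_rep_def)
  \<comment> \<open>In the notation of the introduction, \<open>e i j None\<close> and \<open>e i j (Some \<alpha>)\<close> are the entries of
    \<open>A\<close> and \<open>B\<^sub>\<alpha>\<close>, with rows and columns numbered from \<open>0\<close>.\<close>
  define e where "e i j = coeff_form (M $$ (i, j))" for i j
  have coeff: "Poly_Mapping.lookup (M $$ (0, 0) * M $$ (1, 1)) m =
      Poly_Mapping.lookup (M $$ (0, 1) * M $$ (1, 0)) m + Poly_Mapping.lookup (generic_poly 2 2) m" for m
    using arg_cong [OF det, of "\<lambda>p. Poly_Mapping.lookup p m"] det_2x2 [OF M]
    by (simp add: lookup_minus algebra_simps)
  have singular: "form_mult (e 0 0 None) (e 1 1 None) i j = form_mult (e 0 1 None) (e 1 0 None) i j" for i j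
    using coeff [of "cmon None + (xmon i + xmon j)"]
    by (simp add: lookup_generic_poly_xmon e_def lookup_entry_mult_None [OF span span])
  obtain P k where P: "k < 3" "P k \<noteq> 0"
    and zero: "(\<Sum>i<3. e 0 0 None i * P i) = 0" "(\<Sum>i<3. e 0 1 None i * P i) = 0"
      "(\<Sum>i<3. e 1 0 None i * P i) = 0" "(\<Sum>i<3. e 1 1 None i * P i) = 0"
    by (rule singular_forms_common_zero [OF singular])
  obtain \<alpha> where \<alpha>: "\<alpha> \<in> exponents 2 2" "xpow \<alpha> = xmon k + xmon k"
    using ex_square_exponent [OF P(1)] .
  let ?F = "form_mult :: _ \<Rightarrow> _ \<Rightarrow> _ \<Rightarrow> _ \<Rightarrow> 'k"
  have diff: "(?F (e 0 0 None) (e 1 1 (Some \<alpha>)) i j + ?F (e 0 0 (Some \<alpha>)) (e 1 1 None) i j) =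
      (?F (e 0 1 None) (e 1 0 (Some \<alpha>)) i j + ?F (e 0 1 (Some \<alpha>)) (e 1 0 None) i j) +
      (if i = k \<and> j = k then 1 else 0)" for i j
  proof -
    have "xmon k + xmon k = xmon i + xmon j \<longleftrightarrow> i = k \<and> j = k"
      using xmon_add_eq [of k k i j] by blast
    then show ?thesis
      using coeff [of "cmon (Some \<alpha>) + (xmon i + xmon j)"]
      by (simp add: lookup_generic_poly_xmon e_def lookup_entry_mult_Some [OF span span] \<alpha>)
  qed
  \<comment> \<open>\<open>?ev\<close> evaluates a quadric, given by its coefficients, at \<open>P\<close>.\<close>
  let ?ev = "\<lambda>f. \<Sum>i<3. \<Sum>j\<le>i. f i j * (P i * P j)"
  have ev_add: "?ev (\<lambda>i j. f i j + g i j) = ?ev f + ?ev g" for f g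
    by (simp add: distrib_right sum.distrib)
  have "?ev (\<lambda>i j. ?F (e 0 0 None) (e 1 1 (Some \<alpha>)) i j + ?F (e 0 0 (Some \<alpha>)) (e 1 1 None) i j) = 0"
    unfolding ev_add sum_form_mult zero by simp
  moreover have "?ev (\<lambda>i j. ?F (e 0 1 None) (e 1 0 (Some \<alpha>)) i j + ?F (e 0 1 (Some \<alpha>)) (e 1 0 None) i j) = 0"
    unfolding ev_add sum_form_mult zero by simp
  ultimately have "?ev (\<lambda>i j. if i = k \<and> j = k then 1 else 0) = 0"
    unfolding diff ev_add by simp
  also have "?ev (\<lambda>i j. if i = k \<and> j = k then 1 else 0) = (\<Sum>i<3. if i = k then P k * P k else 0)"
  proof (rule sum.cong)
    show "(\<Sum>j\<le>i. (if i = k \<and> j = k then 1 else 0) * (P i * P j)) = (if i = k then P k * P k else 0)" for i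
    proof -
      have "(\<Sum>j\<le>i. (if i = k \<and> j = k then 1 else 0) * (P i * P j)) =
          (\<Sum>j\<le>i. if j = k then (if i = k then P k * P k else 0) else 0)"
        by (rule sum.cong) simp_all
      then show ?thesis by simp
    qed
  qed simp
  finally show False using P by simp
qed

lemma no_uniform_det_rep_less_2:
  fixes M :: "'k::field gpoly mat"
  assumes "N < 2"
  shows "\<not> uniform_det_rep 2 2 N M"
proof
  assume M: "uniform_det_rep 2 2 N M"
  obtain \<alpha> where \<alpha>: "\<alpha> \<in> exponents 2 2" "xpow \<alpha> = xmon 1 + xmon 1"
    by (rule ex_square_exponent [of 1]) simp_all
  have key: "cmon (Some \<alpha>) + (xmon 1 + xmon 1) \<in> Poly_Mapping.keys (det M)"
  proof -
    have "det M = generic_poly 2 2"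
      using M by (simp add: uniform_det_rep_def)
    then show ?thesis
      by (simp add: in_keys_iff lookup_generic_poly_xmon \<alpha>)
  qed
  have no: "cmon w + xmon v \<noteq> cmon (Some \<alpha>) + (xmon 1 + xmon 1)" for w v
  proof
    assume "cmon w + xmon v = cmon (Some \<alpha>) + (xmon 1 + xmon 1)"
    then have "w = Some \<alpha> \<and> xmon v = xmon 1 + xmon 1"
      by (rule cmon_add_cancel) (simp_all add: lookup_add lookup_xmon)
    then show False
      using xmon_add_eq [of v 0 1 1] by (simp add: xmon_def [of 0])
  qed
  show False
  proof (cases "N = 0")
    case True
    then have "det M = 1"
      using M det_dim_zero unfolding uniform_det_rep_def by blast
    then show False
      using key no [of None 0] by (simp add: cmon_None xmon_def [of 0])
  next
    case False
    then have "N = 1" using assms by simp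
    then have "det M = M $$ (0, 0)" "M $$ (0, 0) \<in> gpoly.span (entry_monomials 2 2)"
      using M det_single [of M] by (simp_all add: uniform_det_rep_def)
    then have "Poly_Mapping.keys (det M) \<subseteq> {cmon w + xmon v | w v. True}"
      by (simp only: keys_entry)
    then have "cmon (Some \<alpha>) + (xmon 1 + xmon 1) \<in> {cmon w + xmon v | w v. True}"
      using key by (rule subsetD)
    then show False
      using no by (elim CollectE exE conjE) metis
  qed
qed

lemma generic_poly_2_2:
  "generic_poly 2 2 = (var (C [0, 0]) + var (C [1, 0]) * var (X 0) + var (C [0, 1]) * var (X 1)
    + var (C [2, 0]) * var (X 0) ^ 2 + var (C [1, 1]) * var (X 0) * var (X 1)
    + var (C [0, 2]) * var (X 1) ^ 2 :: 'k::field gpoly)"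
proof -
  have "exponents 2 2 = {[0, 0], [1, 0], [0, 1], [2, 0], [1, 1], [0, 2]}"
    by (auto simp: exponents_def length_Suc_conv numeral_2_eq_2)
  then show ?thesis
    by (simp add: generic_poly_def numeral_2_eq_2 algebra_simps)
qed

text \<open>A representation of \<open>p\<^bsub>2,2\<^esub>\<close> of size 3. The variables \<open>x\<^sub>1\<close> and \<open>x\<^sub>2\<close> are \<open>X 0\<close> and \<open>X 1\<close>.\<close>
definition rep3 :: "'k::field gpoly mat" where
  "rep3 = mat 3 3 (\<lambda>(i, j).
    [[- var (X 0), 1, 0],
     [- var (X 1), 0, 1],
     [var (C [0, 0]) + var (C [1, 0]) * var (X 0) + var (C [0, 1]) * var (X 1),
      var (C [2, 0]) * var (X 0) + var (C [1, 1]) * var (X 1), var (C [0, 2]) * var (X 1)]] ! i ! j)"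

lemma det_rep3: "det rep3 = generic_poly 2 2"
proof -
  have A: "rep3 \<in> carrier_mat 3 3"
    by (simp add: rep3_def)
  have entries: "rep3 $$ (0, 0) = - var (X 0)" "rep3 $$ (0, 1) = 1" "rep3 $$ (0, 2) = 0"
    by (simp_all add: rep3_def)
  have minor: "det (mat_delete rep3 0 j) =
      mat_delete rep3 0 j $$ (0, 0) * mat_delete rep3 0 j $$ (1, 1) -
      mat_delete rep3 0 j $$ (0, 1) * mat_delete rep3 0 j $$ (1, 0)" for j
    by (rule det_2x2) (simp add: mat_delete_def rep3_def)
  have "det rep3 = (\<Sum>j<3. rep3 $$ (0, j) * cofactor rep3 0 j)"
    by (rule laplace_expansion_row [OF A]) simp
  also have "\<dots> = rep3 $$ (0, 0) * cofactor rep3 0 0 + rep3 $$ (0, 1) * cofactor rep3 0 1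
      + rep3 $$ (0, 2) * cofactor rep3 0 2"
    by (simp add: numeral_3_eq_3 numeral_2_eq_2)
  also have "\<dots> = generic_poly 2 2"
    unfolding entries cofactor_def minor generic_poly_2_2
    by (simp add: mat_delete_def rep3_def algebra_simps power2_eq_square)
  finally show ?thesis .
qed

lemma uniform_det_rep_rep3: "uniform_det_rep 2 2 3 (rep3 :: 'k::field gpoly mat)"
proof -
  let ?E = "entry_monomials 2 2 :: 'k gpoly set"
  have one: "1 \<in> gpoly.span ?E"
    by (rule gpoly.span_base) (simp add: entry_monomials_def)
  have vX: "var (X i) \<in> gpoly.span ?E" if "i < 2" for i
    by (rule gpoly.span_base) (use that in \<open>auto simp: entry_monomials_def\<close>)
  have vC: "var (C \<alpha>) \<in> gpoly.span ?E" if "length \<alpha> = 2" "sum_list \<alpha> \<le> 2" for \<alpha>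
    by (rule gpoly.span_base) (use that in \<open>auto simp: entry_monomials_def exponents_def\<close>)
  have vCX: "var (C \<alpha>) * var (X i) \<in> gpoly.span ?E" if "length \<alpha> = 2" "sum_list \<alpha> \<le> 2" "i < 2" for \<alpha> i
    by (rule gpoly.span_base) (use that in \<open>auto simp: entry_monomials_def exponents_def\<close>)
  have "rep3 $$ (i, j) \<in> gpoly.span ?E" if "i < 3" "j < 3" for i j
  proof -
    have "i = 0 \<or> i = 1 \<or> i = 2" "j = 0 \<or> j = 1 \<or> j = 2" using that by linarith+
    then show ?thesis
      by (elim disjE)
        (simp_all add: rep3_def one vX vC vCX gpoly.span_zero gpoly.span_neg gpoly.span_add)
  qed
  then show ?thesis
    by (simp add: uniform_det_rep_def det_rep3) (simp add: rep3_def)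
qed

theorem proposition6p1:
  shows "Nstar TYPE('k::field) 2 2 = 3"
proof -
  let ?S = "{N. \<exists>M :: 'k gpoly mat. uniform_det_rep 2 2 N M}"
  have "3 \<le> N" if "N \<in> ?S" for N
  proof (rule ccontr)
    assume "\<not> 3 \<le> N"
    then have "N < 2 \<or> N = 2" by linarith
    then show False
      using that no_uniform_det_rep_less_2 no_uniform_det_rep_2 by blast
  qed
  then have "(3::enat) \<le> enat N" if "N \<in> ?S" for N
    using that by (metis enat_ord_simps(1) numeral_eq_enat)
  moreover have "3 \<in> ?S"
    using uniform_det_rep_rep3 by blast
  then have "(INF N\<in>?S. enat N) \<le> 3"
    by (rule INF_lower2) (simp add: numeral_eq_enat)
  ultimately show ?thesis
    unfolding Nstar_def by (intro antisym INF_greatest)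
qed

end
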